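(* Let $\Theta$ be the set of all $\theta\in\mathbb{R}\setminus\{0\}$ such that the backward Riccati recursion (given in the context) is well-defined for $t=0,\ldots,N-1$ and both $$S_t\succ0\quad\text{and}\quad \Xi_t:=\Sigma_t^{-1}-2\theta\tilde H_t\succ0\qquad\text{hold for all } t=0,\ldots,N-1.$$ Then there exists a constant $\bar\theta\in(0,\infty)$ such that $\Theta=(-\infty,\bar\theta)\setminus\{0\}$.
   Context: Notation: $|A|$ is the determinant of a square matrix $A$; $\succ,\succeq$ denote the Loewner order on symmetric matrices. Data: positive integers $n,m,N$; matrices $A_t\in\mathbb{R}^{n\times n}$, $B_t\in\mathbb{R}^{n\times m}$, symmetric $W_t\in\mathbb{R}^{n\times n}$ with $W_t\succ0$, $\Sigma_t\in\mathbb{R}^{m\times m}$ with $\Sigma_t\succ 0$, $R_t\in\mathbb{R}^{m\times m}$ with $R_t\succ0$ ($t=0,\ldots,N-1$), and $Q_t\in\mathbb{R}^{n\times n}$ with $Q_t\succeq0$ ($t=0,\ldots,N$), all fixed and independent of $\theta$. Backward Riccati recursion for a given $\theta$ (all generated quantities depend on $\theta$): $P_N=Q_N$, $\eta_N=0$, and for $t=N-1,\ldots,0$, $$S_t=W_t^{-1}-2\theta P_{t+1},\qquad \tilde P_{t+1}=P_{t+1}+2\theta P_{t+1}S_t^{-1}P_{t+1},\qquad \tilde H_t=R_t+B_t^\top\tilde P_{t+1}B_t,$$ $$P_t=Q_t+A_t^\top\tilde P_{t+1}A_t-A_t^\top\tilde P_{t+1}B_t\tilde H_t^{-1}B_t^\top\tilde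 P_{t+1}A_t,\qquad \eta_t=\eta_{t+1}-\frac{1}{2\theta}\log|S_tW_t|.$$ It is well-defined if all the inverses and logarithms occurring in it exist. *)

theory Defs
  imports "HOL-Analysis.Analysis"
begin

text \<open>Definiteness in the sense of the Loewner order, so symmetry is part of the notion.\<close>

definition pos_semidef :: "real^'n^'n \<Rightarrow> bool" where
  "pos_semidef M \<longleftrightarrow> transpose M = M \<and> (\<forall>x. 0 \<le> x \<bullet> (M *v x))"

definition pos_def :: "real^'n^'n \<Rightarrow> bool" where
  "pos_def M \<longleftrightarrow> transpose M = M \<and> (\<forall>x. x \<noteq> 0 \<longrightarrow> 0 < x \<bullet> (M *v x))"

text \<open>
  One step of the backward recursion, as functions of the successor value
  \<open>P' = P (t + 1)\<close> and of the data at time \<open>t\<close>.  All functions are total; the value of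
  \<^const>\<open>matrix_inv\<close> at a singular matrix is arbitrary and is excluded by the
  predicate \<open>riccati_welldef\<close> below.
\<close>

definition step_S :: "real \<Rightarrow> real^'n^'n \<Rightarrow> real^'n^'n \<Rightarrow> real^'n^'n" where
  "step_S \<theta> W P' = matrix_inv W - (2 * \<theta>) *\<^sub>R P'"

definition step_Ptilde :: "real \<Rightarrow> real^'n^'n \<Rightarrow> real^'n^'n \<Rightarrow> real^'n^'n" where
  "step_Ptilde \<theta> W P' = P' + (2 * \<theta>) *\<^sub>R (P' ** matrix_inv (step_S \<theta> W P') ** P')"

definition step_Htilde ::
    "real \<Rightarrow> real^'m^'n \<Rightarrow> real^'n^'n \<Rightarrow> real^'m^'m \<Rightarrow> real^'n^'n \<Rightarrow> real^'m^'m" where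
  "step_Htilde \<theta> B W R P' = R + transpose B ** step_Ptilde \<theta> W P' ** B"

definition step_P ::
    "real \<Rightarrow> real^'n^'n \<Rightarrow> real^'m^'n \<Rightarrow> real^'n^'n \<Rightarrow> real^'m^'m \<Rightarrow> real^'n^'n
      \<Rightarrow> real^'n^'n \<Rightarrow> real^'n^'n" where
  "step_P \<theta> A B W R Q P' =
     (let Pt = step_Ptilde \<theta> W P' in
      Q + transpose A ** Pt ** A
        - transpose A ** Pt ** B ** matrix_inv (step_Htilde \<theta> B W R P') ** transpose B ** Pt ** A)"

context
  fixes N :: nat
    and A :: "nat \<Rightarrow> real^'n^'n"
    and B :: "nat \<Rightarrow> real^'m^'n"
    and W :: "nat \<Rightarrow> real^'n^'n"
    and R :: "nat \<Rightarrow> real^'m^'m"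
    and Q :: "nat \<Rightarrow> real^'n^'n"
    and \<theta> :: real
begin

text \<open>Only the values at times \<open>t \<le> N\<close> are meaningful.\<close>

function riccati_P :: "nat \<Rightarrow> real^'n^'n" where
  "riccati_P t =
     (if t < N then step_P \<theta> (A t) (B t) (W t) (R t) (Q t) (riccati_P (Suc t)) else Q N)"
  by pat_completeness auto
termination by (relation "Wellfounded.measure (\<lambda>t. N - t)") auto

declare riccati_P.simps [simp del]

definition riccati_S :: "nat \<Rightarrow> real^'n^'n" where
  "riccati_S t = step_S \<theta> (W t) (riccati_P (Suc t))"

definition riccati_Htilde :: "nat \<Rightarrow> real^'m^'m" where
  "riccati_Htilde t = step_Htilde \<theta> (B t) (W t) (R t) (riccati_P (Suc t))"

function riccati_eta :: "nat \<Rightarrow> real" where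
  "riccati_eta t =
     (if t < N
      then riccati_eta (Suc t) - 1 / (2 * \<theta>) * ln (det (riccati_S t ** W t))
      else 0)"
  by pat_completeness auto
termination by (relation "Wellfounded.measure (\<lambda>t. N - t)") auto

declare riccati_eta.simps [simp del]

text \<open>
  The inverses occurring in the recursion are those of \<open>W t\<close>, \<open>riccati_S t\<close> and
  \<open>riccati_Htilde t\<close>; the only logarithm is the one in
  \<^const>\<open>riccati_eta\<close>, whose argument must be positive.
\<close>

definition riccati_welldef :: bool where
  "riccati_welldef \<longleftrightarrow>
     (\<forall>t<N. invertible (W t) \<and> invertible (riccati_S t) \<and> invertible (riccati_Htilde t)
        \<and> det (riccati_S t ** W t) > 0)"

definition riccati_Xi :: "(nat \<Rightarrow> real^'m^'m) \<Rightarrow> nat \<Rightarrow> real^'m^'m" where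
  "riccati_Xi \<Sigma> t = matrix_inv (\<Sigma> t) - (2 * \<theta>) *\<^sub>R riccati_Htilde t"

end

definition admissible_params ::
    "nat \<Rightarrow> (nat \<Rightarrow> real^'n^'n) \<Rightarrow> (nat \<Rightarrow> real^'m^'n) \<Rightarrow> (nat \<Rightarrow> real^'n^'n)
      \<Rightarrow> (nat \<Rightarrow> real^'m^'m) \<Rightarrow> (nat \<Rightarrow> real^'m^'m) \<Rightarrow> (nat \<Rightarrow> real^'n^'n) \<Rightarrow> real set" where
  "admissible_params N A B W \<Sigma> R Q =
     {\<theta>. \<theta> \<noteq> 0 \<and> riccati_welldef N A B W R Q \<theta> \<and>
         (\<forall>t<N. pos_def (riccati_S N A B W R Q \<theta> t) \<and>
                pos_def (riccati_Xi N A B W R Q \<theta> \<Sigma> t))}"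

end

theory Submission
  imports Defs
begin

text \<open>
  Drop the condition \<open>\<theta> \<noteq> 0\<close> and let \<open>G\<close> be the set of all real \<open>\<theta>\<close> for which every \<open>S t\<close>
  and every \<open>\<Xi> t\<close> is positive definite.  The recursion for \<open>P\<close> makes sense at \<open>\<theta> = 0\<close>, and it
  preserves positive semidefiniteness of \<open>P t\<close> as long as the \<open>S t\<close> are positive definite.  Then
  each \<open>H~ t\<close> dominates \<open>R t\<close>, so all inverses and logarithms exist on \<open>G\<close>, and the admissible
  parameters are exactly \<open>G - {0}\<close> (\<open>admissible_params_eq\<close>).  It remains to see that \<open>G\<close> is an
  open ray \<open>{..<\<theta>bar}\<close> with \<open>\<theta>bar > 0\<close>.

  For \<open>\<theta> \<le> 0\<close> the matrices \<open>S t\<close> and \<open>\<Xi> t\<close> are sums of a positive definite and a positive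
  semidefinite matrix, so \<open>G\<close> contains \<open>{..0}\<close> (\<open>nonpos_regular\<close>).

  On the positive half-line \<open>G\<close> is closed downwards because, while \<open>S t\<close> is positive definite,
  one step of the recursion is the value of a game: writing \<open>P~\<close> and \<open>H~\<close> for the matrices with a tilde,
  \<open>x \<bullet> P~ x = max\<^sub>w (x + w) \<bullet> P' (x + w) - (w \<bullet> W\<^bsup>-1\<^esup> w) / (2 \<theta>)\<close> and
  \<open>x \<bullet> P x = x \<bullet> Q x + min\<^sub>u (u \<bullet> R u + (A x + B u) \<bullet> P~ (A x + B u))\<close>.
  The first payoff increases with \<open>\<theta>\<close> and \<open>P'\<close>, the second with \<open>P~\<close>, hence so do \<open>P t\<close>, \<open>H~ t\<close>,
  \<open>\<theta> P t\<close> and \<open>\<theta> H~ t\<close> in the Loewner order, and \<open>S t\<close> and \<open>\<Xi> t\<close> decrease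
  (\<open>step_Ptilde_eq_Max\<close>, \<open>step_P_eq_Min\<close>, \<open>regular_downward\<close>).

  \<open>G\<close> is open, since inversion is continuous and positive definiteness survives small symmetric
  perturbations (\<open>open_regular\<close>).  It is bounded above, since for \<open>\<theta> > 0\<close> the matrix \<open>\<Xi> 0\<close> is
  dominated by the inverse of \<open>\<Sigma> 0\<close> minus \<open>2 \<theta> R 0\<close> (\<open>regular_bdd_above\<close>).  So \<open>\<theta>bar = Sup G\<close> works, and it is
  positive because \<open>0\<close> is an interior point of \<open>G\<close>.
\<close>

(* This rule would rewrite transposes into row-vector products, which the lemmas below do not use. *)
declare transpose_matrix_vector [simp del]

section \<open>Matrix algebra\<close>

lemma transpose_add: "transpose (X + Y) = transpose X + transpose Y"
  by (simp add: transpose_def vec_eq_iff)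

lemma transpose_diff: "transpose (X - Y) = transpose X - transpose (Y :: real^'n^'m)"
  by (simp add: transpose_def vec_eq_iff)

lemma inner_transpose: "x \<bullet> (transpose M *v y) = (M *v x) \<bullet> (y :: real^'m)"
  for M :: "real^'n^'m"
  by (metis dot_lmul_matrix inner_commute transpose_matrix_vector)

lemma inner_symmetric_matrix:
  assumes "transpose M = (M :: real^'n^'n)"
  shows "x \<bullet> (M *v y) = y \<bullet> (M *v x)"
  by (metis assms inner_commute inner_transpose)

lemma inner_congruence:
  fixes M :: "real^'n^'n" and B :: "real^'m^'n"
  shows "x \<bullet> ((transpose B ** M ** B) *v x) = (B *v x) \<bullet> (M *v (B *v x))"
  by (metis inner_transpose matrix_vector_mul_assoc)

lemma matrix_inv_inverse:
  assumes "invertible (M :: real^'n^'n)"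
  shows "M ** matrix_inv M = mat 1" "matrix_inv M ** M = mat 1"
proof -
  have "M ** matrix_inv M = mat 1 \<and> matrix_inv M ** M = mat 1"
    unfolding matrix_inv_def by (rule someI_ex) (use assms invertible_def in blast)
  then show "M ** matrix_inv M = mat 1" "matrix_inv M ** M = mat 1" by auto
qed

lemma transpose_matrix_inv:
  assumes "invertible M" "transpose M = (M :: real^'n^'n)"
  shows "transpose (matrix_inv M) = matrix_inv M"
proof -
  have "transpose (matrix_inv M) ** M = mat 1"
    by (metis assms matrix_inv_inverse(1) matrix_transpose_mul transpose_mat)
  then show ?thesis
    by (metis assms(1) matrix_inv_inverse(1) matrix_mul_assoc matrix_mul_lid matrix_mul_rid)
qed

section \<open>Definiteness\<close>

lemma pos_def_imp_pos_semidef: "pos_def M \<Longrightarrow> pos_semidef M"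
  unfolding pos_def_def pos_semidef_def by (metis inner_zero_left less_eq_real_def)

lemma pos_def_add_pos_semidef:
  assumes "pos_def X" "pos_semidef Y"
  shows "pos_def (X + Y)"
  using assms unfolding pos_def_def pos_semidef_def
  by (simp add: transpose_add matrix_vector_mult_add_rdistrib inner_add_right add_pos_nonneg)

lemma pos_semidef_scaleR:
  assumes "0 \<le> c" "pos_semidef M"
  shows "pos_semidef (c *\<^sub>R M)"
  using assms unfolding pos_semidef_def
  by (simp add: transpose_scalar flip: scaleR_matrix_vector_assoc)

lemma pos_semidef_congruence:
  fixes M :: "real^'n^'n" and B :: "real^'m^'n"
  assumes "pos_semidef M"
  shows "pos_semidef (transpose B ** M ** B)"
  using assms unfolding pos_semidef_def inner_congruence
  by (simp add: matrix_transpose_mul matrix_mul_assoc)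

lemma pos_def_invertible:
  assumes "pos_def (M :: real^'n^'n)"
  shows "invertible M"
proof -
  have "x = 0" if "M *v x = 0" for x
    using assms that unfolding pos_def_def by (metis inner_zero_right less_irrefl)
  then show ?thesis
    by (simp add: invertible_left_inverse matrix_left_invertible_ker)
qed

lemma pos_def_mult_inv: "pos_def M \<Longrightarrow> M *v (matrix_inv M *v x) = x"
  by (simp add: matrix_inv_inverse matrix_vector_mul_assoc pos_def_invertible)

lemma pos_def_symmetric: "pos_def M \<Longrightarrow> transpose M = M"
  by (simp add: pos_def_def)

lemma pos_semidef_symmetric: "pos_semidef M \<Longrightarrow> transpose M = M"
  by (simp add: pos_semidef_def)

lemma pos_def_matrix_inv:
  assumes "pos_def (M :: real^'n^'n)"
  shows "pos_def (matrix_inv M)"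
  unfolding pos_def_def
proof (intro conjI allI impI)
  show "transpose (matrix_inv M) = matrix_inv M"
    by (simp add: assms pos_def_invertible pos_def_symmetric transpose_matrix_inv)
next
  fix x :: "real^'n" assume "x \<noteq> 0"
  let ?y = "matrix_inv M *v x"
  have "M *v ?y = x" by (simp add: assms pos_def_mult_inv)
  moreover from this have "?y \<noteq> 0" using \<open>x \<noteq> 0\<close> by (metis matrix_vector_mult_0_right)
  ultimately show "0 < x \<bullet> ?y"
    using assms unfolding pos_def_def by (metis inner_commute)
qed

abbreviation loewner_le :: "real^'n^'n \<Rightarrow> real^'n^'n \<Rightarrow> bool"  (infix \<open>\<preceq>\<close> 50) where
  "X \<preceq> Y \<equiv> pos_semidef (Y - X)"

lemma loewner_leI:
  assumes "transpose X = X" "transpose Y = Y" "\<And>x. x \<bullet> (X *v x) \<le> x \<bullet> (Y *v x)"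
  shows "X \<preceq> Y"
  using assms unfolding pos_semidef_def
  by (simp add: transpose_diff matrix_vector_mult_diff_rdistrib inner_diff_right)

lemma loewner_leD: "X \<preceq> Y \<Longrightarrow> x \<bullet> (X *v x) \<le> x \<bullet> (Y *v x)"
  unfolding pos_semidef_def by (simp add: matrix_vector_mult_diff_rdistrib inner_diff_right)

lemma pos_def_loewner_mono: "pos_def X \<Longrightarrow> X \<preceq> Y \<Longrightarrow> pos_def Y"
  using pos_def_add_pos_semidef[of X "Y - X"] by simp

text \<open>
  The minimiser is \<open>- M\<^bsup>-1\<^esup> b\<close>: the right-hand side exceeds the left-hand side by the quadratic
  form of \<open>M\<close> at \<open>x + M\<^bsup>-1\<^esup> b\<close>.  The supremum and the infimum that describe a step of the
  recursion are both read off from this.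
\<close>

lemma complete_the_square:
  fixes M :: "real^'n^'n"
  assumes "pos_def M"
  shows "- (b \<bullet> (matrix_inv M *v b)) \<le> x \<bullet> (M *v x) + 2 * (x \<bullet> b)"
    and "\<exists>x. - (b \<bullet> (matrix_inv M *v b)) = x \<bullet> (M *v x) + 2 * (x \<bullet> b)"
proof -
  define y where "y = matrix_inv M *v b"
  have My: "M *v y = b" by (simp add: y_def assms pos_def_mult_inv)
  have sq: "(x + y) \<bullet> (M *v (x + y)) = x \<bullet> (M *v x) + 2 * (x \<bullet> b) + b \<bullet> y" for x
    using inner_symmetric_matrix[OF pos_def_symmetric[OF assms], of y x]
    by (simp add: matrix_vector_right_distrib inner_add_left inner_add_right My inner_commute)
  have "0 \<le> (x + y) \<bullet> (M *v (x + y))"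
    using pos_def_imp_pos_semidef[OF assms] by (simp add: pos_semidef_def)
  then show "- (b \<bullet> (matrix_inv M *v b)) \<le> x \<bullet> (M *v x) + 2 * (x \<bullet> b)"
    using sq[of x] by (simp add: y_def)
  have "- (b \<bullet> y) = (- y) \<bullet> (M *v (- y)) + 2 * ((- y) \<bullet> b)"
    using sq[of "- y"] by simp
  then show "\<exists>x. - (b \<bullet> (matrix_inv M *v b)) = x \<bullet> (M *v x) + 2 * (x \<bullet> b)"
    unfolding y_def by blast
qed

section \<open>Continuity of matrix operations\<close>

lemma tendsto_matrix_mult [tendsto_intros]:
  fixes X :: "real^'n^'m" and Y :: "real^'k^'n"
  assumes "(f \<longlongrightarrow> X) F" "(g \<longlongrightarrow> Y) F"
  shows "((\<lambda>t. f t ** g t) \<longlongrightarrow> X ** Y) F"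
  unfolding matrix_matrix_mult_def
  by (intro vec_tendstoI) (auto intro!: tendsto_intros assms)

lemma tendsto_det [tendsto_intros]:
  fixes X :: "real^'n^'n"
  assumes "(f \<longlongrightarrow> X) F"
  shows "((\<lambda>t. det (f t)) \<longlongrightarrow> det X) F"
  unfolding det_def by (intro tendsto_intros assms)

text \<open>
  The columns of the inverse solve linear systems whose right-hand sides are the unit vectors.
  As a quotient of determinants, the inverse is visibly continuous in the entries.
\<close>

lemma matrix_inv_cramer:
  fixes M :: "real^'n^'n"
  assumes "det M \<noteq> 0"
  shows "matrix_inv M =
    (\<chi> i k. det (\<chi> r c. if c = i then axis k 1 $ r else M $ r $ c) / det M)"
proof -
  have "matrix_inv M *v axis k 1 =
      (\<chi> i. det (\<chi> r c. if c = i then axis k 1 $ r else M $ r $ c) / det M)" for k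
    using cramer[OF assms, of "matrix_inv M *v axis k 1" "axis k 1"] assms
    by (simp add: matrix_vector_mul_assoc matrix_inv_inverse invertible_det_nz)
  moreover have "matrix_inv M $ i $ k = (matrix_inv M *v axis k 1) $ i" for i k
    by (simp add: matrix_vector_mul_component inner_axis)
  ultimately show ?thesis by (simp add: vec_eq_iff)
qed

lemma tendsto_matrix_inv:
  fixes X :: "real^'n^'n"
  assumes f: "(f \<longlongrightarrow> X) F" and X: "invertible X"
  shows "((\<lambda>t. matrix_inv (f t)) \<longlongrightarrow> matrix_inv X) F"
proof -
  have dX: "det X \<noteq> 0" using X invertible_det_nz by blast
  let ?C = "\<lambda>M::real^'n^'n.
    \<chi> i k. det (\<chi> r c. if c = i then axis k 1 $ r else M $ r $ c) / det M"
  have comp: "((\<lambda>t. if c = i then axis k 1 $ r else f t $ r $ c) \<longlongrightarrow>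
      (if c = i then axis k 1 $ r else X $ r $ c)) F" for i k r c
    by (auto intro!: tendsto_intros f)
  have num: "((\<lambda>t. \<chi> r c. if c = i then axis k 1 $ r else f t $ r $ c) \<longlongrightarrow>
      (\<chi> r c. if c = i then axis k 1 $ r else X $ r $ c)) F" for i k
    by (intro vec_tendstoI) (unfold vec_lambda_beta, rule comp)
  have "((\<lambda>t. ?C (f t)) \<longlongrightarrow> ?C X) F"
    by (intro vec_tendstoI, unfold vec_lambda_beta)
      (rule tendsto_divide[OF tendsto_det[OF num] tendsto_det[OF f] dX])
  moreover have "\<forall>\<^sub>F t in F. det (f t) \<noteq> 0"
    using tendsto_det[OF f] dX tendsto_imp_eventually_ne by blast
  then have "\<forall>\<^sub>F t in F. ?C (f t) = matrix_inv (f t)"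
    by eventually_elim (simp add: matrix_inv_cramer)
  ultimately show ?thesis
    unfolding matrix_inv_cramer[OF dX] by (rule Lim_transform_eventually)
qed

text \<open>
  The segment from the identity to \<open>M\<close> consists of positive definite matrices, so the determinant
  does not vanish along it and keeps the sign that it has at the identity.
\<close>

lemma pos_def_det_pos:
  fixes M :: "real^'n^'n"
  assumes "pos_def M"
  shows "det M > 0"
proof (rule ccontr)
  define f where "f t = (1 - t) *\<^sub>R mat 1 + t *\<^sub>R M" for t :: real
  have nz: "det (f t) \<noteq> 0" if t: "0 \<le> t" "t \<le> 1" for t
  proof -
    have "pos_def (f t)" unfolding pos_def_def
    proof (intro conjI allI impI)
      show "transpose (f t) = f t"
        using assms by (simp add: f_def transpose_add transpose_scalar transpose_mat pos_def_def)
      fix x :: "real^'n" assume x: "x \<noteq> 0"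
      have "x \<bullet> (f t *v x) = (1 - t) * (x \<bullet> x) + t * (x \<bullet> (M *v x))"
        by (simp add: f_def matrix_vector_mult_add_rdistrib inner_add_right
            flip: scaleR_matrix_vector_assoc)
      moreover have "0 < x \<bullet> x" "0 < x \<bullet> (M *v x)"
        using x assms by (auto simp: pos_def_def)
      ultimately show "0 < x \<bullet> (f t *v x)"
        using t by (cases "t = 0") (auto intro: add_nonneg_pos)
    qed
    then show ?thesis using pos_def_invertible invertible_det_nz by blast
  qed
  have cont: "continuous_on {0..1} (\<lambda>t. det (f t))"
    unfolding continuous_on_def f_def by (auto intro!: tendsto_intros)
  assume "\<not> det M > 0"
  then have "\<exists>t\<ge>0. t \<le> 1 \<and> det (f t) = 0"
    by (intro IVT2' cont) (auto simp: f_def)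
  then show False using nz by blast
qed

text \<open>
  On the unit sphere the quadratic form of \<open>X\<close> is bounded below by some \<open>c > 0\<close>, by
  compactness.  A perturbation whose form is smaller than \<open>c\<close> on the sphere preserves positivity
  there, and hence everywhere by homogeneity.
\<close>

lemma eventually_pos_def:
  fixes X :: "real^'n^'n"
  assumes f: "(f \<longlongrightarrow> X) F" and X: "pos_def X"
    and sym: "\<forall>\<^sub>F t in F. transpose (f t) = f t"
  shows "\<forall>\<^sub>F t in F. pos_def (f t)"
proof -
  have "continuous_on (sphere 0 1) (\<lambda>x. x \<bullet> (X *v x))"
    by (intro continuous_intros)
  moreover have "sphere (0::real^'n) 1 \<noteq> {}" by simp
  ultimately obtain u :: "real^'n" where u: "norm u = 1"
    and min: "\<And>v. norm v = 1 \<Longrightarrow> u \<bullet> (X *v u) \<le> v \<bullet> (X *v v)"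
    using continuous_attains_inf[OF compact_sphere, of 0 1 "\<lambda>x. x \<bullet> (X *v x)"]
    by (auto simp: dist_norm)
  define c where "c = u \<bullet> (X *v u)"
  have "u \<noteq> 0" using u by auto
  then have c: "0 < c" using X by (simp add: c_def pos_def_def)
  have "bilinear ((*v) :: real^'n^'n \<Rightarrow> real^'n \<Rightarrow> real^'n)"
    unfolding bilinear_def
    by (auto simp: linear_iff algebra_simps matrix_vector_mult_scaleR
        simp flip: scaleR_matrix_vector_assoc)
  then have "bounded_bilinear ((*v) :: real^'n^'n \<Rightarrow> real^'n \<Rightarrow> real^'n)"
    by (simp add: bilinear_conv_bounded_bilinear)
  then obtain K where K: "0 < K"
    and bound: "\<And>(M :: real^'n^'n) x. norm (M *v x) \<le> norm M * norm x * K"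
    using bounded_bilinear.pos_bounded by blast
  have "\<forall>\<^sub>F t in F. dist (f t) X < c / K"
    using f c K by (simp add: tendstoD)
  then show ?thesis using sym
  proof eventually_elim
    case (elim t)
    show ?case unfolding pos_def_def
    proof (intro conjI allI impI)
      show "transpose (f t) = f t" by fact
      fix x :: "real^'n" assume x: "x \<noteq> 0"
      define v where "v = x /\<^sub>R norm x"
      have v: "norm v = 1" and xv: "x = norm x *\<^sub>R v" using x by (auto simp: v_def)
      have "\<bar>v \<bullet> ((f t - X) *v v)\<bar> \<le> norm v * norm ((f t - X) *v v)"
        by (rule Cauchy_Schwarz_ineq2)
      also have "\<dots> \<le> norm (f t - X) * K" using bound[of "f t - X" v] v by simp
      also have "\<dots> < c" using elim(1) K by (simp add: dist_norm field_simps)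
      finally have "0 < v \<bullet> (f t *v v)"
        using min[OF v] by (simp add: c_def matrix_vector_mult_diff_rdistrib inner_diff_right)
      moreover have "x \<bullet> (f t *v x) = (norm x)\<^sup>2 * (v \<bullet> (f t *v v))"
        by (subst (1 2) xv) (simp add: matrix_vector_mult_scaleR power2_eq_square)
      ultimately show "0 < x \<bullet> (f t *v x)" using x by simp
    qed
  qed
qed

section \<open>One step of the recursion\<close>

lemma transpose_step_S:
  assumes "pos_def W" "transpose P' = P'"
  shows "transpose (step_S \<theta> W P') = step_S \<theta> W P'"
  using assms pos_def_symmetric[OF pos_def_matrix_inv[OF assms(1)]]
  by (simp add: step_S_def transpose_diff transpose_scalar)

lemma transpose_step_Ptilde:
  assumes "transpose P' = P'" "pos_def (step_S \<theta> W P')"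
  shows "transpose (step_Ptilde \<theta> W P') = step_Ptilde \<theta> W P'"
  using assms pos_def_symmetric[OF pos_def_matrix_inv[OF assms(2)]]
  by (simp add: step_Ptilde_def transpose_add transpose_scalar matrix_transpose_mul matrix_mul_assoc)

text \<open>
  For \<open>\<theta> \<ge> 0\<close> the correction added to \<open>P'\<close> is itself positive semidefinite.  For \<open>\<theta> < 0\<close> it
  is subtracted; formally the intermediate matrix is the inverse of \<open>P'\<^bsup>-1\<^esup> - 2 \<theta> W\<close>.  Since \<open>P'\<close>
  may be singular, the proof uses instead the vector \<open>y = S\<^bsup>-1\<^esup> P' x\<close>, which satisfies
  \<open>W\<^bsup>-1\<^esup> y = P' (x + 2 \<theta> y)\<close>, and writes the quadratic form as a sum of two nonnegative terms.
\<close>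

lemma pos_semidef_step_Ptilde:
  assumes W: "pos_def W" and P: "pos_semidef P'" and S: "pos_def (step_S \<theta> W P')"
  shows "pos_semidef (step_Ptilde \<theta> W P')"
  unfolding pos_semidef_def
proof (intro conjI allI)
  note symP = pos_semidef_symmetric[OF P]
  show "transpose (step_Ptilde \<theta> W P') = step_Ptilde \<theta> W P'"
    using symP S by (rule transpose_step_Ptilde)
  fix x
  define y where "y = matrix_inv (step_S \<theta> W P') *v (P' *v x)"
  have Pt: "step_Ptilde \<theta> W P' *v x = P' *v x + (2 * \<theta>) *\<^sub>R (P' *v y)"
    by (simp add: step_Ptilde_def y_def matrix_vector_mult_add_rdistrib matrix_vector_mul_assoc
        matrix_mul_assoc flip: scaleR_matrix_vector_assoc)
  have "step_S \<theta> W P' *v y = P' *v x"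
    by (simp add: y_def S pos_def_mult_inv)
  then have Wy: "matrix_inv W *v y = P' *v x + (2 * \<theta>) *\<^sub>R (P' *v y)"
    by (simp add: step_S_def matrix_vector_mult_diff_rdistrib algebra_simps
        flip: scaleR_matrix_vector_assoc)
  have W0: "0 \<le> y \<bullet> (matrix_inv W *v y)"
    using pos_def_imp_pos_semidef[OF pos_def_matrix_inv[OF W]] by (simp add: pos_semidef_def)
  have P0: "0 \<le> z \<bullet> (P' *v z)" for z using P by (simp add: pos_semidef_def)
  show "0 \<le> x \<bullet> (step_Ptilde \<theta> W P' *v x)"
  proof (cases "\<theta> \<ge> 0")
    case True
    have "0 \<le> (P' *v x) \<bullet> y"
      using pos_def_imp_pos_semidef[OF pos_def_matrix_inv[OF S]]
      by (simp add: y_def pos_semidef_def)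
    then have "0 \<le> x \<bullet> (P' *v y)"
      by (metis inner_commute inner_symmetric_matrix symP)
    then show ?thesis using True P0[of x] by (simp add: Pt inner_add_right)
  next
    case False
    let ?z = "x + (2 * \<theta>) *\<^sub>R y"
    have "x \<bullet> (step_Ptilde \<theta> W P' *v x)
        = ?z \<bullet> (P' *v ?z) - 2 * \<theta> * (y \<bullet> (matrix_inv W *v y))"
      by (simp add: Pt Wy algebra_simps inner_add_left inner_add_right matrix_vector_mult_scaleR)
    moreover have "2 * \<theta> * (y \<bullet> (matrix_inv W *v y)) \<le> 0"
      using False mult_nonpos_nonneg[of "2 * \<theta>", OF _ W0] by simp
    ultimately show ?thesis using P0[of ?z] by simp
  qed
qed

text \<open>
  As a function of \<open>w\<close> the payoff is a concave quadratic with Hessian \<open>- S / \<theta>\<close>, which is negative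
  definite; its value at the maximiser \<open>w = 2 \<theta> S\<^bsup>-1\<^esup> P' x\<close> is the form of the intermediate matrix.
  In the payoff, unlike in the formula with \<open>S\<^bsup>-1\<^esup>\<close>, the monotone dependence on \<open>\<theta>\<close> and on \<open>P'\<close>
  is evident.
\<close>

lemma step_Ptilde_eq_Max:
  assumes \<theta>: "0 < \<theta>" and symP: "transpose P' = P'" and S: "pos_def (step_S \<theta> W P')"
  shows "(x + w) \<bullet> (P' *v (x + w)) - (w \<bullet> (matrix_inv W *v w)) / (2 * \<theta>)
           \<le> x \<bullet> (step_Ptilde \<theta> W P' *v x)"
    and "\<exists>w. x \<bullet> (step_Ptilde \<theta> W P' *v x)
           = (x + w) \<bullet> (P' *v (x + w)) - (w \<bullet> (matrix_inv W *v w)) / (2 * \<theta>)"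
proof -
  let ?S = "step_S \<theta> W P'"
  define q where "q = (P' *v x) \<bullet> (matrix_inv ?S *v (P' *v x))"
  \<comment> \<open>Up to a constant, \<open>- 2 * \<theta>\<close> times the payoff is \<open>w \<bullet> (?S *v w) + 2 * (w \<bullet> b)\<close>.\<close>
  define b where "b = (- 2 * \<theta>) *\<^sub>R (P' *v x)"
  have Pt: "x \<bullet> (step_Ptilde \<theta> W P' *v x) = x \<bullet> (P' *v x) + 2 * \<theta> * q"
    using inner_symmetric_matrix[OF symP, of "matrix_inv ?S *v (P' *v x)" x]
    by (simp add: step_Ptilde_def q_def matrix_vector_mult_add_rdistrib inner_add_right inner_commute
        flip: scaleR_matrix_vector_assoc matrix_vector_mul_assoc)
  have b: "b \<bullet> (matrix_inv ?S *v b) = 4 * \<theta>\<^sup>2 * q"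
    unfolding b_def q_def matrix_vector_mult_scaleR by (simp add: power2_eq_square)
  have payoff: "(x + w) \<bullet> (P' *v (x + w)) - (w \<bullet> (matrix_inv W *v w)) / (2 * \<theta>)
      = x \<bullet> (P' *v x) - (w \<bullet> (?S *v w) + 2 * (w \<bullet> b)) / (2 * \<theta>)" for w
    using \<theta> inner_symmetric_matrix[OF symP, of x w]
    by (simp add: step_S_def b_def matrix_vector_mult_diff_rdistrib matrix_vector_right_distrib
        inner_add_left inner_add_right inner_diff_right field_simps
        flip: scaleR_matrix_vector_assoc)
  have val: "x \<bullet> (step_Ptilde \<theta> W P' *v x)
      = x \<bullet> (P' *v x) - (- (b \<bullet> (matrix_inv ?S *v b))) / (2 * \<theta>)"
    using \<theta> by (simp add: Pt b power2_eq_square)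
  show "(x + w) \<bullet> (P' *v (x + w)) - (w \<bullet> (matrix_inv W *v w)) / (2 * \<theta>)
           \<le> x \<bullet> (step_Ptilde \<theta> W P' *v x)"
    unfolding payoff val
    using complete_the_square(1)[OF S, of b w] \<theta> by (intro diff_left_mono divide_right_mono) auto
  show "\<exists>w. x \<bullet> (step_Ptilde \<theta> W P' *v x)
           = (x + w) \<bullet> (P' *v (x + w)) - (w \<bullet> (matrix_inv W *v w)) / (2 * \<theta>)"
    unfolding payoff val using complete_the_square(2)[OF S, of b] by metis
qed

lemma pos_def_step_Htilde:
  assumes "pos_def W" "pos_def R" "pos_semidef P'" "pos_def (step_S \<theta> W P')"
  shows "pos_def (step_Htilde \<theta> B W R P')"
  unfolding step_Htilde_def
  by (intro pos_def_add_pos_semidef pos_semidef_congruence pos_semidef_step_Ptilde assms)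

lemma transpose_step_P:
  assumes "transpose Q = Q" "transpose (step_Ptilde \<theta> W P') = step_Ptilde \<theta> W P'"
    and "pos_def (step_Htilde \<theta> B W R P')"
  shows "transpose (step_P \<theta> A B W R Q P') = step_P \<theta> A B W R Q P'"
  using assms pos_def_symmetric[OF pos_def_matrix_inv[OF assms(3)]]
  by (simp add: step_P_def Let_def transpose_add transpose_diff matrix_transpose_mul matrix_mul_assoc)

text \<open>
  The Bellman equation: as a function of the control \<open>u\<close> the cost is a quadratic with matrix
  \<open>H~\<close>, and the term subtracted in the Riccati formula is what the best control saves over
  \<open>u = 0\<close>.
\<close>

lemma step_P_eq_Min:
  fixes B :: "real^'m^'n"
  assumes symPt: "transpose (step_Ptilde \<theta> W P') = step_Ptilde \<theta> W P'"
    and H: "pos_def (step_Htilde \<theta> B W R P')"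
  shows "x \<bullet> (step_P \<theta> A B W R Q P' *v x)
           \<le> x \<bullet> (Q *v x) + u \<bullet> (R *v u)
             + (A *v x + B *v u) \<bullet> (step_Ptilde \<theta> W P' *v (A *v x + B *v u))"
    and "\<exists>u. x \<bullet> (step_P \<theta> A B W R Q P' *v x)
           = x \<bullet> (Q *v x) + u \<bullet> (R *v u)
             + (A *v x + B *v u) \<bullet> (step_Ptilde \<theta> W P' *v (A *v x + B *v u))"
proof -
  let ?H = "step_Htilde \<theta> B W R P'"
  define Pt where "Pt = step_Ptilde \<theta> W P'"
  note symPt = symPt[folded Pt_def]
  define y where "y = A *v x"
  define b where "b = transpose B *v (Pt *v y)"
  have cost: "x \<bullet> (Q *v x) + u \<bullet> (R *v u) + (y + B *v u) \<bullet> (Pt *v (y + B *v u))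
      = x \<bullet> (Q *v x) + y \<bullet> (Pt *v y) + (u \<bullet> (?H *v u) + 2 * (u \<bullet> b))" for u
    using inner_symmetric_matrix[OF symPt, of y "B *v u"]
    by (simp add: step_Htilde_def b_def inner_transpose inner_congruence inner_add_left
        inner_add_right matrix_vector_mult_add_rdistrib matrix_vector_right_distrib flip: Pt_def)
  have "y \<bullet> (Pt *v (B *v z)) = b \<bullet> z" for z
    using inner_symmetric_matrix[OF symPt, of y "B *v z"]
    by (simp add: b_def inner_transpose inner_commute[of _ z])
  then have val: "x \<bullet> (step_P \<theta> A B W R Q P' *v x)
      = x \<bullet> (Q *v x) + y \<bullet> (Pt *v y) + - (b \<bullet> (matrix_inv ?H *v b))"
    by (simp add: step_P_def Let_def y_def b_def inner_transpose inner_add_right inner_diff_right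
        matrix_vector_mult_add_rdistrib matrix_vector_mult_diff_rdistrib
        flip: Pt_def matrix_vector_mul_assoc)
  show "x \<bullet> (step_P \<theta> A B W R Q P' *v x)
           \<le> x \<bullet> (Q *v x) + u \<bullet> (R *v u)
             + (A *v x + B *v u) \<bullet> (step_Ptilde \<theta> W P' *v (A *v x + B *v u))"
    using complete_the_square(1)[OF H, of b u]
    unfolding Pt_def[symmetric] y_def[symmetric] val cost by simp
  show "\<exists>u. x \<bullet> (step_P \<theta> A B W R Q P' *v x)
           = x \<bullet> (Q *v x) + u \<bullet> (R *v u)
             + (A *v x + B *v u) \<bullet> (step_Ptilde \<theta> W P' *v (A *v x + B *v u))"
    using complete_the_square(2)[OF H, of b]
    unfolding Pt_def[symmetric] y_def[symmetric] val cost by metis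
qed

lemma pos_semidef_step_P:
  assumes "pos_def W" "pos_def R" "pos_semidef Q" "pos_semidef P'" "pos_def (step_S \<theta> W P')"
  shows "pos_semidef (step_P \<theta> A B W R Q P')"
  unfolding pos_semidef_def
proof (intro conjI allI)
  note Pt = pos_semidef_step_Ptilde[OF assms(1,4,5)]
  note H = pos_def_step_Htilde[OF assms(1,2,4,5)]
  show "transpose (step_P \<theta> A B W R Q P') = step_P \<theta> A B W R Q P'"
    using assms(3) Pt H by (intro transpose_step_P) (auto simp: pos_semidef_symmetric)
  fix x
  obtain u where "x \<bullet> (step_P \<theta> A B W R Q P' *v x)
      = x \<bullet> (Q *v x) + u \<bullet> (R *v u)
        + (A *v x + B *v u) \<bullet> (step_Ptilde \<theta> W P' *v (A *v x + B *v u))"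
    using step_P_eq_Min(2)[OF pos_semidef_symmetric[OF Pt] H] by blast
  then show "0 \<le> x \<bullet> (step_P \<theta> A B W R Q P' *v x)"
    using Pt assms(3) pos_def_imp_pos_semidef[OF assms(2)] by (simp add: pos_semidef_def)
qed

section \<open>Monotonicity of one step in the risk parameter\<close>

text \<open>
  Here \<open>\<theta> > 0\<close> and the semidefiniteness of the matrices combine: \<open>\<theta> P \<preceq> \<theta> P' \<preceq> \<theta>' P'\<close>.
\<close>

lemma step_S_antimono:
  assumes W: "pos_def W" and \<theta>: "0 < \<theta>" "\<theta> \<le> \<theta>'"
    and P: "pos_semidef P" "pos_semidef P'" "P \<preceq> P'"
  shows "step_S \<theta>' W P' \<preceq> step_S \<theta> W P"
proof (rule loewner_leI)
  fix x
  have "\<theta> * (x \<bullet> (P *v x)) \<le> \<theta>' * (x \<bullet> (P' *v x))"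
    using \<theta> P(1) loewner_leD[OF P(3), of x] by (intro mult_mono) (auto simp: pos_semidef_def)
  then show "x \<bullet> (step_S \<theta>' W P' *v x) \<le> x \<bullet> (step_S \<theta> W P *v x)"
    by (simp add: step_S_def matrix_vector_mult_diff_rdistrib inner_diff_right
        flip: scaleR_matrix_vector_assoc)
qed (use W P in \<open>auto simp: transpose_step_S pos_semidef_symmetric\<close>)

text \<open>
  Evaluate both suprema at a maximiser \<open>w\<close> of the smaller problem.
\<close>

lemma step_Ptilde_mono:
  assumes W: "pos_def W" and \<theta>: "0 < \<theta>" "\<theta> \<le> \<theta>'"
    and P: "pos_semidef P" "pos_semidef P'" "P \<preceq> P'"
    and S': "pos_def (step_S \<theta>' W P')"
  shows "step_Ptilde \<theta> W P \<preceq> step_Ptilde \<theta>' W P'"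
proof (rule loewner_leI)
  note symP = pos_semidef_symmetric[OF P(1)] and symP' = pos_semidef_symmetric[OF P(2)]
  have S: "pos_def (step_S \<theta> W P)"
    using S' step_S_antimono[OF W \<theta> P] by (rule pos_def_loewner_mono)
  show "transpose (step_Ptilde \<theta> W P) = step_Ptilde \<theta> W P"
    "transpose (step_Ptilde \<theta>' W P') = step_Ptilde \<theta>' W P'"
    using transpose_step_Ptilde symP symP' S S' by auto
  fix x
  obtain w where "x \<bullet> (step_Ptilde \<theta> W P *v x)
      = (x + w) \<bullet> (P *v (x + w)) - (w \<bullet> (matrix_inv W *v w)) / (2 * \<theta>)"
    using step_Ptilde_eq_Max(2)[OF \<theta>(1) symP S] by blast
  also have "\<dots> \<le> (x + w) \<bullet> (P' *v (x + w)) - (w \<bullet> (matrix_inv W *v w)) / (2 * \<theta>')"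
    using \<theta> pos_def_imp_pos_semidef[OF pos_def_matrix_inv[OF W]]
    by (intro diff_mono loewner_leD[OF P(3)] divide_left_mono) (auto simp: pos_semidef_def)
  also have "\<dots> \<le> x \<bullet> (step_Ptilde \<theta>' W P' *v x)"
    using \<theta> by (intro step_Ptilde_eq_Max(1) symP' S') auto
  finally show "x \<bullet> (step_Ptilde \<theta> W P *v x) \<le> x \<bullet> (step_Ptilde \<theta>' W P' *v x)" .
qed

lemma step_Htilde_mono:
  assumes "step_Ptilde \<theta> W P \<preceq> step_Ptilde \<theta>' W P'"
  shows "step_Htilde \<theta> B W R P \<preceq> step_Htilde \<theta>' B W R P'"
proof -
  have "step_Htilde \<theta>' B W R P' - step_Htilde \<theta> B W R P
      = transpose B ** (step_Ptilde \<theta>' W P' - step_Ptilde \<theta> W P) ** B"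
    unfolding step_Htilde_def
    by (simp add: matrix_eq matrix_vector_mult_diff_rdistrib matrix_vector_mult_diff_distrib
        matrix_vector_mult_add_rdistrib flip: matrix_vector_mul_assoc)
  then show ?thesis using pos_semidef_congruence[OF assms] by simp
qed

text \<open>
  Evaluate both infima at a minimiser \<open>u\<close> of the larger problem.
\<close>

lemma step_P_mono:
  assumes W: "pos_def W" and R: "pos_def R" and Q: "pos_semidef Q"
    and \<theta>: "0 < \<theta>" "\<theta> \<le> \<theta>'"
    and P: "pos_semidef P" "pos_semidef P'" "P \<preceq> P'"
    and S': "pos_def (step_S \<theta>' W P')"
  shows "step_P \<theta> A B W R Q P \<preceq> step_P \<theta>' A B W R Q P'"
proof (rule loewner_leI)
  have S: "pos_def (step_S \<theta> W P)"
    using S' step_S_antimono[OF W \<theta> P] by (rule pos_def_loewner_mono)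
  note Pt = pos_semidef_step_Ptilde[OF W P(1) S] and Pt' = pos_semidef_step_Ptilde[OF W P(2) S']
  note H = pos_def_step_Htilde[OF W R P(1) S] and H' = pos_def_step_Htilde[OF W R P(2) S']
  show "transpose (step_P \<theta> A B W R Q P) = step_P \<theta> A B W R Q P"
    "transpose (step_P \<theta>' A B W R Q P') = step_P \<theta>' A B W R Q P'"
    using pos_semidef_step_P[OF W R Q P(1) S] pos_semidef_step_P[OF W R Q P(2) S']
    by (auto simp: pos_semidef_symmetric)
  fix x
  obtain u where u: "x \<bullet> (step_P \<theta>' A B W R Q P' *v x)
      = x \<bullet> (Q *v x) + u \<bullet> (R *v u)
        + (A *v x + B *v u) \<bullet> (step_Ptilde \<theta>' W P' *v (A *v x + B *v u))"
    using step_P_eq_Min(2)[OF pos_semidef_symmetric[OF Pt'] H'] by blast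
  have "x \<bullet> (step_P \<theta> A B W R Q P *v x)
      \<le> x \<bullet> (Q *v x) + u \<bullet> (R *v u)
        + (A *v x + B *v u) \<bullet> (step_Ptilde \<theta> W P *v (A *v x + B *v u))"
    by (rule step_P_eq_Min(1)[OF pos_semidef_symmetric[OF Pt] H])
  also have "\<dots> \<le> x \<bullet> (step_P \<theta>' A B W R Q P' *v x)"
    unfolding u by (intro add_left_mono loewner_leD step_Ptilde_mono W \<theta> P S')
  finally show "x \<bullet> (step_P \<theta> A B W R Q P *v x) \<le> x \<bullet> (step_P \<theta>' A B W R Q P' *v x)" .
qed

section \<open>The whole recursion\<close>

context
  fixes N :: nat
    and A :: "nat \<Rightarrow> real^'n^'n"
    and B :: "nat \<Rightarrow> real^'m^'n"
    and W :: "nat \<Rightarrow> real^'n^'n"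
    and \<Sigma> :: "nat \<Rightarrow> real^'m^'m"
    and R :: "nat \<Rightarrow> real^'m^'m"
    and Q :: "nat \<Rightarrow> real^'n^'n"
  assumes W: "\<And>t. t < N \<Longrightarrow> pos_def (W t)"
    and \<Sigma>: "\<And>t. t < N \<Longrightarrow> pos_def (\<Sigma> t)"
    and R: "\<And>t. t < N \<Longrightarrow> pos_def (R t)"
    and Q: "\<And>t. t \<le> N \<Longrightarrow> pos_semidef (Q t)"
begin

abbreviation "P \<equiv> riccati_P N A B W R Q"
abbreviation "S \<equiv> riccati_S N A B W R Q"
abbreviation "H \<equiv> riccati_Htilde N A B W R Q"
abbreviation "\<Xi> \<theta> \<equiv> riccati_Xi N A B W R Q \<theta> \<Sigma>"

lemma P_terminal: "P \<theta> N = Q N"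
  by (simp add: riccati_P.simps)

lemma P_step: "t < N \<Longrightarrow> P \<theta> t = step_P \<theta> (A t) (B t) (W t) (R t) (Q t) (P \<theta> (Suc t))"
  by (simp add: riccati_P.simps)

text \<open>
  The positive definiteness of \<open>S s\<close> may itself be derived from the semidefiniteness of
  \<open>P (s + 1)\<close>: for \<open>\<theta> \<le> 0\<close> this is how it is obtained.  Restricting \<open>s\<close> to later times makes
  the lemma usable inside a backward induction that establishes positive definiteness of \<open>S\<close>.
\<close>

lemma pos_semidef_P:
  assumes "t \<le> N"
    and "\<And>s. t \<le> s \<Longrightarrow> s < N \<Longrightarrow> pos_semidef (P \<theta> (Suc s)) \<Longrightarrow> pos_def (S \<theta> s)"
  shows "pos_semidef (P \<theta> t)"
  using assms(1)
proof (induction rule: inc_induct)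
  case base
  then show ?case by (simp add: P_terminal Q)
next
  case (step s)
  then show ?case
    using assms(2)[of s]
    by (simp add: P_step riccati_S_def pos_semidef_step_P W R Q)
qed

text \<open>
  Keeping \<open>\<theta> = 0\<close> in the set fills the gap in the ray.  Well-definedness of the recursion is not
  demanded here because it follows from the two conditions.
\<close>

definition regular :: "real set" where
  "regular = {\<theta>. \<forall>t<N. pos_def (S \<theta> t) \<and> pos_def (\<Xi> \<theta> t)}"

lemma regular_pos_semidef_P: "\<theta> \<in> regular \<Longrightarrow> t \<le> N \<Longrightarrow> pos_semidef (P \<theta> t)"
  by (rule pos_semidef_P) (auto simp: regular_def)

lemma pos_def_H:
  assumes "t < N" "pos_semidef (P \<theta> (Suc t))" "pos_def (S \<theta> t)"
  shows "pos_def (H \<theta> t)"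
  using assms by (simp add: riccati_Htilde_def riccati_S_def pos_def_step_Htilde W R)

lemma regular_pos_def_H: "\<theta> \<in> regular \<Longrightarrow> t < N \<Longrightarrow> pos_def (H \<theta> t)"
  by (rule pos_def_H) (auto simp: regular_pos_semidef_P, auto simp: regular_def)

lemma admissible_params_eq: "admissible_params N A B W \<Sigma> R Q = regular - {0}"
proof -
  have "riccati_welldef N A B W R Q \<theta>" if "\<theta> \<in> regular" for \<theta>
    unfolding riccati_welldef_def
  proof (intro allI impI conjI)
    fix t assume t: "t < N"
    then have S: "pos_def (S \<theta> t)" using that by (simp add: regular_def)
    show "invertible (W t)" "invertible (S \<theta> t)" "invertible (H \<theta> t)"
      using S W[OF t] regular_pos_def_H[OF that t] by (auto simp: pos_def_invertible)
    show "0 < det (S \<theta> t ** W t)"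
      using S W[OF t] by (simp add: det_mul pos_def_det_pos)
  qed
  then show ?thesis
    by (auto simp: admissible_params_def regular_def)
qed

lemma nonpos_regular:
  assumes "\<theta> \<le> 0"
  shows "\<theta> \<in> regular"
proof -
  have S: "pos_def (S \<theta> t)" if t: "t < N" and P: "pos_semidef (P \<theta> (Suc t))" for t
    using pos_def_add_pos_semidef[OF pos_def_matrix_inv[OF W[OF t]]
        pos_semidef_scaleR[of "- (2 * \<theta>)", OF _ P]] assms
    by (simp add: riccati_S_def step_S_def)
  have P: "pos_semidef (P \<theta> t)" if "t \<le> N" for t
    using that S by (rule pos_semidef_P)
  have "pos_def (\<Xi> \<theta> t)" if t: "t < N" for t
  proof -
    have "pos_def (H \<theta> t)" using t P S by (simp add: pos_def_H)
    then show ?thesis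
      using pos_def_add_pos_semidef[OF pos_def_matrix_inv[OF \<Sigma>[OF t]]
          pos_semidef_scaleR[of "- (2 * \<theta>)", OF _ pos_def_imp_pos_semidef]] assms
      by (simp add: riccati_Xi_def)
  qed
  then show ?thesis using S P by (simp add: regular_def)
qed

lemma P_mono:
  assumes \<theta>: "0 < \<theta>" "\<theta> \<le> \<theta>'" and reg: "\<theta>' \<in> regular" and "t \<le> N"
  shows "pos_semidef (P \<theta> t) \<and> P \<theta> t \<preceq> P \<theta>' t"
  using \<open>t \<le> N\<close>
proof (induction rule: inc_induct)
  case base
  have "pos_semidef (0 :: real^'n^'n)"
    by (simp add: pos_semidef_def transpose_def vec_eq_iff)
  then show ?case by (simp add: P_terminal Q)
next
  case (step t)
  have P': "pos_semidef (P \<theta>' (Suc t))" using step.hyps reg by (simp add: regular_pos_semidef_P)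
  have S': "pos_def (step_S \<theta>' (W t) (P \<theta>' (Suc t)))"
    using step.hyps reg by (simp add: regular_def riccati_S_def)
  have S: "pos_def (step_S \<theta> (W t) (P \<theta> (Suc t)))"
    using S' step_S_antimono[OF W \<theta>] P' step by (blast intro: pos_def_loewner_mono)
  show ?case
    using step W[of t] R[of t] Q[of t] \<theta> P' S S'
    by (simp add: P_step pos_semidef_step_P step_P_mono)
qed

lemma regular_downward:
  assumes \<theta>: "0 < \<theta>" "\<theta> \<le> \<theta>'" and reg: "\<theta>' \<in> regular"
  shows "\<theta> \<in> regular"
  unfolding regular_def
proof (intro CollectI allI impI conjI)
  fix t assume t: "t < N"
  have P: "pos_semidef (P \<theta> (Suc t))" "pos_semidef (P \<theta>' (Suc t))" "P \<theta> (Suc t) \<preceq> P \<theta>' (Suc t)"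
    using P_mono[OF \<theta> reg, of "Suc t"] regular_pos_semidef_P[OF reg, of "Suc t"] t by auto
  have S': "pos_def (S \<theta>' t)" and Xi': "pos_def (\<Xi> \<theta>' t)"
    using reg t by (auto simp: regular_def)
  show S: "pos_def (S \<theta> t)"
    using S' step_S_antimono[OF W[OF t] \<theta> P] unfolding riccati_S_def
    by (rule pos_def_loewner_mono)
  have H: "pos_def (H \<theta> t)" "pos_def (H \<theta>' t)" using t P S S' by (auto simp: pos_def_H)
  have HH: "H \<theta> t \<preceq> H \<theta>' t"
    using step_Ptilde_mono[OF W[OF t] \<theta> P] S' unfolding riccati_Htilde_def riccati_S_def
    by (intro step_Htilde_mono) auto
  have "\<Xi> \<theta>' t \<preceq> \<Xi> \<theta> t"
  proof (rule loewner_leI)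
    have "transpose (matrix_inv (\<Sigma> t)) = matrix_inv (\<Sigma> t)"
      using pos_def_matrix_inv[OF \<Sigma>[OF t]] by (rule pos_def_symmetric)
    then show "transpose (\<Xi> \<theta>' t) = \<Xi> \<theta>' t" "transpose (\<Xi> \<theta> t) = \<Xi> \<theta> t"
      using H by (auto simp: riccati_Xi_def transpose_diff transpose_scalar pos_def_symmetric)
    fix x
    have "\<theta> * (x \<bullet> (H \<theta> t *v x)) \<le> \<theta>' * (x \<bullet> (H \<theta>' t *v x))"
      using \<theta> loewner_leD[OF HH, of x] pos_def_imp_pos_semidef[OF H(1)]
      by (intro mult_mono) (auto simp: pos_semidef_def)
    then show "x \<bullet> (\<Xi> \<theta>' t *v x) \<le> x \<bullet> (\<Xi> \<theta> t *v x)"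
      by (simp add: riccati_Xi_def matrix_vector_mult_diff_rdistrib inner_diff_right
          flip: scaleR_matrix_vector_assoc)
  qed
  with Xi' show "pos_def (\<Xi> \<theta> t)" by (rule pos_def_loewner_mono)
qed

text \<open>
  At any fixed \<open>x \<noteq> 0\<close>, positivity of \<open>\<Xi> 0\<close> gives
  \<open>2 \<theta> (x \<bullet> R\<^sub>0 x) \<le> 2 \<theta> (x \<bullet> H~\<^sub>0 x) < x \<bullet> \<Sigma>\<^sub>0\<^bsup>-1\<^esup> x\<close> when \<open>\<theta> > 0\<close>, and \<open>R 0\<close> does not depend
  on \<open>\<theta>\<close>.
\<close>

lemma regular_bdd_above:
  assumes "N \<ge> 1"
  shows "bdd_above regular"
proof -
  obtain x :: "real^'m" where x: "x \<noteq> 0" using axis_eq_0_iff zero_neq_one by metis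
  define a where "a = x \<bullet> (matrix_inv (\<Sigma> 0) *v x)"
  define r where "r = x \<bullet> (R 0 *v x)"
  have r: "0 < r" using R[of 0] assms x by (simp add: r_def pos_def_def)
  have "\<theta> \<le> max 0 (a / (2 * r))" if reg: "\<theta> \<in> regular" for \<theta>
  proof (cases "\<theta> > 0")
    case True
    have "pos_semidef (P \<theta> (Suc 0))" and S: "pos_def (S \<theta> 0)" and Xi: "pos_def (\<Xi> \<theta> 0)"
      using reg assms regular_pos_semidef_P[OF reg, of "Suc 0"] by (auto simp: regular_def)
    then have "R 0 \<preceq> H \<theta> 0"
      using W[of 0] assms
      by (simp add: riccati_Htilde_def step_Htilde_def riccati_S_def
          pos_semidef_congruence pos_semidef_step_Ptilde)
    then have "r \<le> x \<bullet> (H \<theta> 0 *v x)" unfolding r_def by (rule loewner_leD)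
    moreover have "2 * \<theta> * (x \<bullet> (H \<theta> 0 *v x)) < a"
      using Xi x by (simp add: pos_def_def a_def riccati_Xi_def matrix_vector_mult_diff_rdistrib
          inner_diff_right flip: scaleR_matrix_vector_assoc)
    ultimately have "2 * \<theta> * r \<le> a"
      using True by (smt (verit) mult_left_mono)
    then show ?thesis using r by (simp add: field_simps le_max_iff_disj)
  qed auto
  then show ?thesis by (rule bdd_aboveI)
qed

lemma tendsto_P:
  assumes reg: "\<theta> \<in> regular" and "t \<le> N"
  shows "((\<lambda>\<theta>'. P \<theta>' t) \<longlongrightarrow> P \<theta> t) (at \<theta>)"
  using \<open>t \<le> N\<close>
proof (induction rule: inc_induct)
  case base
  then show ?case by (simp add: P_terminal)
next
  case (step t)
  have "invertible (step_S \<theta> (W t) (P \<theta> (Suc t)))"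
    "invertible (step_Htilde \<theta> (B t) (W t) (R t) (P \<theta> (Suc t)))"
    using reg step.hyps regular_pos_def_H[OF reg, of t]
    by (auto simp: regular_def riccati_S_def riccati_Htilde_def pos_def_invertible)
  then have "((\<lambda>\<theta>'. step_P \<theta>' (A t) (B t) (W t) (R t) (Q t) (P \<theta>' (Suc t)))
      \<longlongrightarrow> step_P \<theta> (A t) (B t) (W t) (R t) (Q t) (P \<theta> (Suc t))) (at \<theta>)"
    unfolding step_P_def Let_def step_Htilde_def step_Ptilde_def step_S_def
    by (intro tendsto_intros tendsto_matrix_inv step.IH)
  then show ?case using step.hyps by (simp add: P_step)
qed

text \<open>
  Backward induction on \<open>t\<close>, because the perturbation lemma needs symmetric matrices: \<open>S\<close> at time
  \<open>t\<close> is known to be symmetric for nearby parameters only once the later \<open>S\<close> are known to be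
  positive definite there, which makes \<open>P\<close> at time \<open>t + 1\<close> positive semidefinite.
\<close>

lemma eventually_regular:
  assumes reg: "\<theta> \<in> regular"
  shows "\<forall>\<^sub>F \<theta>' in at \<theta>. \<theta>' \<in> regular"
proof -
  have "\<forall>\<^sub>F \<theta>' in at \<theta>. \<forall>s. t \<le> s \<longrightarrow> s < N \<longrightarrow> pos_def (S \<theta>' s) \<and> pos_def (\<Xi> \<theta>' s)"
    if "t \<le> N" for t
    using that
  proof (induction rule: inc_induct)
    case base
    then show ?case by simp
  next
    case (step t)
    then have t: "t < N" by simp
    have P: "((\<lambda>\<theta>'. P \<theta>' (Suc t)) \<longlongrightarrow> P \<theta> (Suc t)) (at \<theta>)"
      using tendsto_P[OF reg] t by simp
    have S: "pos_def (S \<theta> t)" and Xi: "pos_def (\<Xi> \<theta> t)"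
      using reg t by (auto simp: regular_def)
    have limS: "((\<lambda>\<theta>'. S \<theta>' t) \<longlongrightarrow> S \<theta> t) (at \<theta>)"
      unfolding riccati_S_def step_S_def by (intro tendsto_intros P)
    then have limXi: "((\<lambda>\<theta>'. \<Xi> \<theta>' t) \<longlongrightarrow> \<Xi> \<theta> t) (at \<theta>)"
      using pos_def_invertible[OF S]
      unfolding riccati_Xi_def riccati_Htilde_def step_Htilde_def step_Ptilde_def riccati_S_def
      by (intro tendsto_intros tendsto_matrix_inv P)
    have evP: "\<forall>\<^sub>F \<theta>' in at \<theta>. pos_semidef (P \<theta>' (Suc t))"
      using step.IH by eventually_elim (use t in \<open>auto intro: pos_semidef_P\<close>)
    then have "\<forall>\<^sub>F \<theta>' in at \<theta>. transpose (S \<theta>' t) = S \<theta>' t"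
      by eventually_elim (simp add: riccati_S_def transpose_step_S W t pos_semidef_symmetric)
    with limS S have evS: "\<forall>\<^sub>F \<theta>' in at \<theta>. pos_def (S \<theta>' t)" by (rule eventually_pos_def)
    have sym\<Sigma>: "transpose (matrix_inv (\<Sigma> t)) = matrix_inv (\<Sigma> t)"
      using pos_def_matrix_inv[OF \<Sigma>[OF t]] by (rule pos_def_symmetric)
    have "\<forall>\<^sub>F \<theta>' in at \<theta>. transpose (\<Xi> \<theta>' t) = \<Xi> \<theta>' t"
      using evP evS
      by eventually_elim
        (use t in \<open>simp add: riccati_Xi_def transpose_diff transpose_scalar sym\<Sigma>
           pos_def_symmetric[OF pos_def_H]\<close>)
    with limXi Xi have evXi: "\<forall>\<^sub>F \<theta>' in at \<theta>. pos_def (\<Xi> \<theta>' t)" by (rule eventually_pos_def)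
    show ?case
      using step.IH evS evXi
      by eventually_elim (metis Suc_leI le_neq_implies_less)
  qed
  from this[of 0] show ?thesis by (simp add: regular_def)
qed

lemma open_regular: "open regular"
proof (rule open_subopen[THEN iffD2], rule ballI)
  fix \<theta> assume reg: "\<theta> \<in> regular"
  obtain U where U: "open U" "\<theta> \<in> U" "\<forall>\<theta>'\<in>U. \<theta>' \<noteq> \<theta> \<longrightarrow> \<theta>' \<in> regular"
    using eventually_regular[OF reg] by (auto simp: eventually_at_topological)
  then show "\<exists>U. open U \<and> \<theta> \<in> U \<and> U \<subseteq> regular"
    using U reg by (intro exI[of _ U]) auto
qed

lemma regular_eq_ray:
  assumes "N \<ge> 1"
  shows "regular = {..<Sup regular}" and "0 < Sup regular"
proof -
  have 0: "0 \<in> regular" by (simp add: nonpos_regular)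
  have below: "\<exists>\<theta>'>\<theta>. \<theta>' \<in> regular" if "\<theta> \<in> regular" for \<theta>
  proof -
    have "\<theta> < \<theta> + 1" by simp
    then obtain b where "\<theta> < b" "{\<theta>..<b} \<subseteq> regular"
      using open_right[OF open_regular \<open>\<theta> \<in> regular\<close>] by blast
    then show ?thesis by (intro exI[of _ "(\<theta> + b) / 2"]) auto
  qed
  have less: "\<theta> < Sup regular" if "\<theta> \<in> regular" for \<theta>
    using below[OF that] cSup_upper[OF _ regular_bdd_above[OF assms]]
    by (meson less_le_trans)
  then show "0 < Sup regular" using 0 by blast
  have "\<theta> \<in> regular" if "\<theta> < Sup regular" for \<theta>
  proof (cases "\<theta> \<le> 0")
    case False
    obtain \<theta>' where "\<theta>' \<in> regular" "\<theta> < \<theta>'"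
      using less_cSupD[OF _ \<open>\<theta> < Sup regular\<close>] 0 by blast
    then show ?thesis using False by (intro regular_downward[of \<theta> \<theta>']) auto
  qed (rule nonpos_regular)
  then show "regular = {..<Sup regular}" using less by auto
qed

end

theorem lemma2:
  fixes N :: nat
    and A :: "nat \<Rightarrow> real^'n^'n"
    and B :: "nat \<Rightarrow> real^'m^'n"
    and W :: "nat \<Rightarrow> real^'n^'n"
    and \<Sigma> :: "nat \<Rightarrow> real^'m^'m"
    and R :: "nat \<Rightarrow> real^'m^'m"
    and Q :: "nat \<Rightarrow> real^'n^'n"
  assumes "N \<ge> 1"
    and "\<And>t. t < N \<Longrightarrow> pos_def (W t)"
    and "\<And>t. t < N \<Longrightarrow> pos_def (\<Sigma> t)"
    and "\<And>t. t < N \<Longrightarrow> pos_def (R t)"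
    and "\<And>t. t \<le> N \<Longrightarrow> pos_semidef (Q t)"
  shows "\<exists>\<theta>bar::real. 0 < \<theta>bar \<and> admissible_params N A B W \<Sigma> R Q = {..<\<theta>bar} - {0}"
proof -
  let ?G = "regular N A B W \<Sigma> R Q"
  have "admissible_params N A B W \<Sigma> R Q = ?G - {0}"
    by (rule admissible_params_eq[OF assms(2-5)])
  moreover have "?G = {..<Sup ?G}"
    by (rule regular_eq_ray(1)[OF assms(2-5,1)])
  moreover have "0 < Sup ?G"
    by (rule regular_eq_ray(2)[OF assms(2-5,1)])
  ultimately show ?thesis by blast
qed

end
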